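(* Let $X=\{x_i\}_{i=1}^r$ be a finite set of points in $\mathbb{CH}^n=\mathbb{B}^n$, and $H=DA_n(X)$. Then $X$ lies in a geodesic (1) if and only if for any $1\le i<j<k\le r$ we have $A_{ijk}=0$ and $LF_{ijk}=\delta_{ik}$; (2) if and only if for any $1\le i<j<k\le r$ we have $A_{ijk}=0$ and $\det MQ_1(\{x_i,x_j,x_k\})=0$.
   Context: $\mathbb{B}^n\subset\mathbb{C}^n$ is the open unit ball, the model of complex hyperbolic space $\mathbb{CH}^n$ with its $\operatorname{Aut}(\mathbb{B}^n)$-invariant Bergman-Poincaré Riemannian metric; the geodesics are the images of $\{(x,0,\dots,0):x\in(-1,1)\}$ under biholomorphic automorphisms of $\mathbb{B}^n$. $DA_n$ is the Hilbert space of holomorphic functions on $\mathbb{B}^n$ with kernels $k_z(w)=(1-\langle w,z\rangle)^{-1}$, and $DA_n(X)$ is the span of $\{k_x\}_{x\in X}$. Put $k_{ij}=\langle k_{x_i},k_{x_j}\rangle=(1-\langle x_j,x_i\rangle)^{-1}$. Then $\delta_{ij}=\left(1-\frac{|k_{ij}|^2}{k_{ii}k_{jj}}\right)^{1/2}$, $A_{ijk}=\arg(k_{ij}k_{jk}k_{ki})$ with $|\arg|\le\pi$, and $LF_{ijk}\ge0$ with $LF_{ijk}^2=\frac1{\delta_{ij}^2}\left|1-\frac{k_{ji}k_{ik}}{k_{jk}k_{ii}}\right|^2$. For an ordered set $Z=\{z_1,\dots,z_N\}\subset\mathbb{B}^n$ with kernel Gram entries $\kappa_{ab}=(1-\langle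 z_b,z_a\rangle)^{-1}$, $MQ_1(Z)$ is the $(N-1)\times(N-1)$ matrix $\left(1-\frac{\kappa_{a1}\kappa_{1b}}{\kappa_{ab}\kappa_{11}}\right)_{2\le a,b\le N}$; in (2), the subscript $1$ refers to the first listed point $x_i$. *)

theory Defs
  imports "HOL-Analysis.Analysis"
begin

definition cdot :: "complex^'n \<Rightarrow> complex^'n \<Rightarrow> complex" where
  "cdot w z = (\<Sum>i\<in>UNIV. w $ i * cnj (z $ i))"

text \<open>Holomorphy in several complex variables. Both predicates are meant for open sets \<open>S\<close>.\<close>

definition sv_holomorphic_on :: "(complex^'n \<Rightarrow> complex) \<Rightarrow> (complex^'n) set \<Rightarrow> bool" where
  "sv_holomorphic_on f S \<longleftrightarrow>
     (\<forall>z\<in>S. \<exists>L. (f has_derivative L) (at z) \<and> (\<forall>c v. L (c *s v) = c * L v))"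

definition sv_holomorphic_map_on :: "(complex^'n \<Rightarrow> complex^'m) \<Rightarrow> (complex^'n) set \<Rightarrow> bool" where
  "sv_holomorphic_map_on f S \<longleftrightarrow> (\<forall>i. sv_holomorphic_on (\<lambda>z. f z $ i) S)"

definition ball_automorphism :: "(complex^'n \<Rightarrow> complex^'n) \<Rightarrow> bool" where
  "ball_automorphism f \<longleftrightarrow>
     bij_betw f (ball 0 1) (ball 0 1) \<and>
     sv_holomorphic_map_on f (ball 0 1) \<and>
     sv_holomorphic_map_on (inv_into (ball 0 1) f) (ball 0 1)"

text \<open>The coordinates are ordered by the order of the index type, so \<open>Min UNIV\<close> is the first one
  and \<open>axis (Min UNIV) (of_real t)\<close> is the point \<open>(t, 0, \<dots>, 0)\<close>.\<close>

definition geodesic :: "(complex^'n::{finite,linorder}) set \<Rightarrow> bool" where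
  "geodesic G \<longleftrightarrow>
     (\<exists>f. ball_automorphism f \<and>
          G = f ` {axis (Min UNIV) (of_real t) | t::real. - 1 < t \<and> t < 1})"

definition lies_in_geodesic :: "(complex^'n::{finite,linorder}) set \<Rightarrow> bool" where
  "lies_in_geodesic X \<longleftrightarrow> (\<exists>G. geodesic G \<and> X \<subseteq> G)"

text \<open>A Hilbert space whose elements are complex-valued functions, with pointwise operations and an
  inner product that is linear in the first argument.\<close>

locale hilbert_function_space =
  fixes H :: "('a \<Rightarrow> complex) set"
    and ip :: "('a \<Rightarrow> complex) \<Rightarrow> ('a \<Rightarrow> complex) \<Rightarrow> complex"
  assumes zero_mem: "(\<lambda>w. 0) \<in> H"
    and add_mem: "f \<in> H \<Longrightarrow> g \<in> H \<Longrightarrow> (\<lambda>w. f w + g w) \<in> H"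
    and scale_mem: "f \<in> H \<Longrightarrow> (\<lambda>w. c * f w) \<in> H"
    and ip_add: "f \<in> H \<Longrightarrow> g \<in> H \<Longrightarrow> h \<in> H \<Longrightarrow> ip (\<lambda>w. f w + g w) h = ip f h + ip g h"
    and ip_scale: "f \<in> H \<Longrightarrow> h \<in> H \<Longrightarrow> ip (\<lambda>w. c * f w) h = c * ip f h"
    and ip_cnj: "f \<in> H \<Longrightarrow> g \<in> H \<Longrightarrow> ip g f = cnj (ip f g)"
    and ip_pos: "f \<in> H \<Longrightarrow> f \<noteq> (\<lambda>w. 0) \<Longrightarrow> Re (ip f f) > 0"
    and complete:
      "(\<forall>n. F n \<in> H) \<Longrightarrow>
       (\<forall>e>0. \<exists>N. \<forall>m\<ge>N. \<forall>n\<ge>N.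
          sqrt (Re (ip (\<lambda>w. F m w - F n w) (\<lambda>w. F m w - F n w))) < e) \<Longrightarrow>
       \<exists>f\<in>H. (\<lambda>n. sqrt (Re (ip (\<lambda>w. F n w - f w) (\<lambda>w. F n w - f w)))) \<longlonglongrightarrow> 0"

text \<open>A function on the ball is represented by its extension by zero, so that equality of functions
  on the ball is equality in HOL.\<close>

definition da_kernel :: "complex^'n \<Rightarrow> complex^'n \<Rightarrow> complex" where
  "da_kernel z w = (if w \<in> ball 0 1 then inverse (1 - cdot w z) else 0)"

text \<open>The Drury-Arveson space as the reproducing kernel Hilbert space of the kernel above. By the
  Moore-Aronszajn theorem the kernel determines \<open>H\<close> and the values of \<open>ip\<close> on \<open>H\<close>.\<close>

locale drury_arveson_space = hilbert_function_space H ip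
  for H :: "(complex^'n \<Rightarrow> complex) set" and ip +
  assumes holomorphic: "f \<in> H \<Longrightarrow> sv_holomorphic_on f (ball 0 1)"
    and zero_outside: "f \<in> H \<Longrightarrow> w \<notin> ball 0 1 \<Longrightarrow> f w = 0"
    and kernel_mem: "z \<in> ball 0 1 \<Longrightarrow> da_kernel z \<in> H"
    and reproducing: "f \<in> H \<Longrightarrow> z \<in> ball 0 1 \<Longrightarrow> ip f (da_kernel z) = f z"

definition kernel_gram ::
  "((complex^'n \<Rightarrow> complex) \<Rightarrow> (complex^'n \<Rightarrow> complex) \<Rightarrow> complex)
     \<Rightarrow> complex^'n \<Rightarrow> complex^'n \<Rightarrow> complex" where
  "kernel_gram ip z w = ip (da_kernel z) (da_kernel w)"

text \<open>Invariants of a Gram matrix \<open>k\<close>. The diagonal entries are squared norms, hence real, and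
  \<open>Re\<close> only changes their type.\<close>

definition delta :: "(nat \<Rightarrow> nat \<Rightarrow> complex) \<Rightarrow> nat \<Rightarrow> nat \<Rightarrow> real" where
  "delta k i j = sqrt (1 - (cmod (k i j))\<^sup>2 / (Re (k i i) * Re (k j j)))"

definition angular :: "(nat \<Rightarrow> nat \<Rightarrow> complex) \<Rightarrow> nat \<Rightarrow> nat \<Rightarrow> nat \<Rightarrow> real" where
  "angular k i j l = Arg (k i j * k j l * k l i)"

definition LF :: "(nat \<Rightarrow> nat \<Rightarrow> complex) \<Rightarrow> nat \<Rightarrow> nat \<Rightarrow> nat \<Rightarrow> real" where
  "LF k i j l =
     sqrt (1 / (delta k i j)\<^sup>2 * (cmod (1 - (k j i * k i l) / (k j l * k i i)))\<^sup>2)"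

text \<open>The matrix \<open>MQ\<^sub>1(Z)\<close> for \<open>Z = {p, z $ 1, z $ 2, \<dots>}\<close>: \<open>p\<close> is the first listed point and the
  remaining \<open>N - 1\<close> points are indexed by a type with \<open>N - 1\<close> elements. The first argument is the
  Gram kernel.\<close>

definition MQ1 ::
  "('p \<Rightarrow> 'p \<Rightarrow> complex) \<Rightarrow> 'p \<Rightarrow> 'p^'m \<Rightarrow> complex^'m^'m" where
  "MQ1 \<kappa> p z =
     (\<chi> a b. 1 - (\<kappa> (z $ a) p * \<kappa> p (z $ b)) / (\<kappa> (z $ a) (z $ b) * \<kappa> p p))"

end

theory Submission
  imports Defs "HOL-Complex_Analysis.Conformal_Mappings"
begin

text \<open>The Moebius involutions of the ball change the Gram matrix only by factors \<open>\<gamma> w * cnj (\<gamma> z)\<close>,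
  so vanishing of \<open>A\<close> and the entries of \<open>MQ\<^sub>1\<close> are invariant and the first point may be moved to the
  origin. There the conditions on \<open>{0, y, z}\<close> say that \<open>\<langle>z, y\<rangle>\<close> is real and that equality holds in the
  Cauchy-Schwarz inequality, i.e. that \<open>z\<close> is a real multiple of \<open>y\<close>. Conversely, by the Schwarz lemma on
  complex discs, an automorphism fixing the origin maps real diameters to real diameters, so every
  geodesic is a Moebius image of a diameter. The conditions on \<open>LF\<close> and on \<open>det MQ\<^sub>1\<close> agree because the
  diagonal entries of \<open>MQ\<^sub>1\<close> are the \<open>\<delta>\<^sup>2\<close>.\<close>

section \<open>The Hermitian inner product\<close>

lemma cdot_add_left: "cdot (u + v) z = cdot u z + cdot v z"
  and cdot_diff_left: "cdot (u - v) z = cdot u z - cdot v z"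
  and cdot_scale_left: "cdot (c *s v) z = c * cdot v z"
  and cdot_add_right: "cdot z (u + v) = cdot z u + cdot z v"
  and cdot_diff_right: "cdot z (u - v) = cdot z u - cdot z v"
  and cdot_scale_right: "cdot z (c *s v) = cnj c * cdot z v"
  and cdot_zero_left [simp]: "cdot 0 z = 0"
  and cdot_zero_right [simp]: "cdot z 0 = 0"
  by (simp_all add: cdot_def algebra_simps sum.distrib sum_subtractf sum_distrib_left)

lemmas cdot_simps = cdot_add_left cdot_diff_left cdot_scale_left
  cdot_add_right cdot_diff_right cdot_scale_right

lemma cnj_cdot: "cnj (cdot z w) = cdot w z"
  by (simp add: cdot_def mult.commute)

lemma cdot_self: "cdot z z = of_real ((norm z)\<^sup>2)"
proof -
  have "(norm z)\<^sup>2 = (\<Sum>i\<in>UNIV. (cmod (z $ i))\<^sup>2)"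
    by (simp add: norm_vec_def L2_set_def sum_nonneg)
  then show ?thesis
    by (simp add: cdot_def complex_norm_square [symmetric])
qed

lemma norm_sq_cdot: "(norm z)\<^sup>2 = Re (cdot z z)"
  by (simp add: cdot_self)

lemma norm_cdot_le: "cmod (cdot z w) \<le> norm z * norm w"
proof -
  have "cmod (cdot z w) \<le> (\<Sum>i\<in>UNIV. \<bar>cmod (z $ i)\<bar> * \<bar>cmod (w $ i)\<bar>)"
    unfolding cdot_def by (rule order_trans [OF norm_sum]) (simp add: norm_mult)
  also have "\<dots> \<le> norm z * norm w"
    unfolding norm_vec_def by (rule L2_set_mult_ineq)
  finally show ?thesis .
qed

lemma norm_scale_vec: "norm (c *s v :: complex^'n) = cmod c * norm v"
proof -
  have "cdot (c *s v) (c *s v) = (c * cnj c) * cdot v v"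
    by (simp add: cdot_simps)
  then have "(norm (c *s v))\<^sup>2 = (cmod c * norm v)\<^sup>2"
    by (simp add: cdot_self power_mult_distrib flip: complex_norm_square of_real_power of_real_mult)
  then show ?thesis
    by simp
qed

lemma cdot_ball_lt_1:
  assumes "z \<in> ball 0 1" "w \<in> ball 0 1"
  shows "cmod (cdot z w) < 1"
proof -
  have "norm z * norm w < 1 * 1"
    using assms by (intro mult_strict_mono') auto
  then show ?thesis
    using norm_cdot_le [of z w] by simp
qed

lemma one_minus_cdot_nonzero:
  assumes "z \<in> ball 0 1" "w \<in> ball 0 1"
  shows "1 - cdot z w \<noteq> 0"
  using cdot_ball_lt_1 [OF assms] by auto

section \<open>Holomorphic maps of the ball\<close>

lemma sv_holomorphic_on_const: "sv_holomorphic_on (\<lambda>z. c) S"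
  unfolding sv_holomorphic_on_def by (auto intro!: exI [of _ "\<lambda>_. 0"])

lemma sv_holomorphic_on_nth: "sv_holomorphic_on (\<lambda>z. z $ i) S"
  unfolding sv_holomorphic_on_def
  by (auto intro!: exI [of _ "\<lambda>z. z $ i"] bounded_linear_imp_has_derivative)

lemma sv_holomorphic_on_add:
  assumes "sv_holomorphic_on f S" "sv_holomorphic_on g S"
  shows "sv_holomorphic_on (\<lambda>z. f z + g z) S"
  unfolding sv_holomorphic_on_def
proof
  fix z assume "z \<in> S"
  then obtain L M where
    "(f has_derivative L) (at z)" "\<forall>c v. L (c *s v) = c * L v"
    "(g has_derivative M) (at z)" "\<forall>c v. M (c *s v) = c * M v"
    using assms unfolding sv_holomorphic_on_def by meson
  then show "\<exists>L. ((\<lambda>z. f z + g z) has_derivative L) (at z) \<and> (\<forall>c v. L (c *s v) = c * L v)"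
    by (intro exI [of _ "\<lambda>v. L v + M v"]) (auto intro!: has_derivative_add simp: algebra_simps)
qed

lemma sv_holomorphic_on_mult:
  assumes "sv_holomorphic_on f S" "sv_holomorphic_on g S"
  shows "sv_holomorphic_on (\<lambda>z. f z * g z) S"
  unfolding sv_holomorphic_on_def
proof
  fix z assume "z \<in> S"
  then obtain L M where
    "(f has_derivative L) (at z)" "\<forall>c v. L (c *s v) = c * L v"
    "(g has_derivative M) (at z)" "\<forall>c v. M (c *s v) = c * M v"
    using assms unfolding sv_holomorphic_on_def by meson
  then show "\<exists>L. ((\<lambda>z. f z * g z) has_derivative L) (at z) \<and> (\<forall>c v. L (c *s v) = c * L v)"
    using has_derivative_mult [of f L z UNIV g M]
    by (intro exI [of _ "\<lambda>v. f z * M v + L v * g z"]) (auto simp: algebra_simps)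
qed

lemma sv_holomorphic_on_inverse:
  assumes "sv_holomorphic_on f S" "\<And>z. z \<in> S \<Longrightarrow> f z \<noteq> 0"
  shows "sv_holomorphic_on (\<lambda>z. inverse (f z)) S"
  unfolding sv_holomorphic_on_def
proof
  fix z assume "z \<in> S"
  then obtain L where
    "(f has_derivative L) (at z)" "\<forall>c v. L (c *s v) = c * L v" "f z \<noteq> 0"
    using assms unfolding sv_holomorphic_on_def by meson
  then show "\<exists>L. ((\<lambda>z. inverse (f z)) has_derivative L) (at z) \<and> (\<forall>c v. L (c *s v) = c * L v)"
    using Deriv.has_derivative_inverse [of f z L UNIV]
    by (intro exI [of _ "\<lambda>v. - (inverse (f z) * L v * inverse (f z))"]) (auto simp: algebra_simps)
qed

lemma sv_holomorphic_on_sum: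
  assumes "\<And>i. i \<in> I \<Longrightarrow> sv_holomorphic_on (f i) S"
  shows "sv_holomorphic_on (\<lambda>z. \<Sum>i\<in>I. f i z) S"
  using assms
  by (induction I rule: infinite_finite_induct)
    (auto intro: sv_holomorphic_on_const sv_holomorphic_on_add)

lemma sv_holomorphic_on_cdot:
  assumes "sv_holomorphic_map_on f S"
  shows "sv_holomorphic_on (\<lambda>z. cdot (f z) a) S"
  using assms unfolding cdot_def sv_holomorphic_map_on_def
  by (intro sv_holomorphic_on_sum sv_holomorphic_on_mult sv_holomorphic_on_const) auto

lemma sv_holomorphic_map_on_ident: "sv_holomorphic_map_on (\<lambda>z. z) S"
  by (simp add: sv_holomorphic_map_on_def sv_holomorphic_on_nth)

text \<open>Holomorphy of \<open>g\<close> is given coordinatewise, so the derivatives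
  \<open>M i\<close> are first assembled into one linear map; the chain rule then gives
  \<open>L\<close> after that map, which is again complex linear.\<close>

lemma sv_holomorphic_on_compose:
  fixes f :: "complex^'c \<Rightarrow> complex"
  assumes f: "sv_holomorphic_on f T" and g: "sv_holomorphic_map_on g S"
    and "\<And>z. z \<in> S \<Longrightarrow> g z \<in> T"
  shows "sv_holomorphic_on (\<lambda>z. f (g z)) S"
  unfolding sv_holomorphic_on_def
proof
  fix z assume z: "z \<in> S"
  obtain L where L: "(f has_derivative L) (at (g z))" "\<And>c v. L (c *s v) = c * L v"
    using f assms(3) [OF z] unfolding sv_holomorphic_on_def by meson
  obtain M where M: "\<And>i. ((\<lambda>z. g z $ i) has_derivative M i) (at z)"
    "\<And>i c v. M i (c *s v) = c * M i v"
  proof -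
    have "\<forall>i. \<exists>L. ((\<lambda>z. g z $ i) has_derivative L) (at z) \<and> (\<forall>c v. L (c *s v) = c * L v)"
      using g z unfolding sv_holomorphic_map_on_def sv_holomorphic_on_def by blast
    from choice [OF this] show thesis
      using that by blast
  qed
  have "(g has_derivative (\<lambda>v. \<chi> i. M i v)) (at z)"
  proof (subst has_derivative_componentwise_within, rule ballI)
    fix b :: "complex^'c" assume "b \<in> Basis"
    then obtain i u where b: "b = axis i u"
      unfolding Basis_vec_def by blast
    show "((\<lambda>z. g z \<bullet> b) has_derivative (\<lambda>v. (\<chi> i. M i v) \<bullet> b)) (at z)"
      unfolding b inner_axis vec_lambda_beta by (rule has_derivative_inner_left [OF M(1)])
  qed
  from diff_chain_at [OF this L(1)]
  have "((\<lambda>z. f (g z)) has_derivative (\<lambda>v. L (\<chi> i. M i v))) (at z)"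
    by (simp add: o_def)
  moreover have "(\<chi> i. M i (c *s v)) = c *s (\<chi> i. M i v)" for c v
    by (simp add: M(2) vec_eq_iff)
  ultimately show "\<exists>L. ((\<lambda>z. f (g z)) has_derivative L) (at z) \<and> (\<forall>c v. L (c *s v) = c * L v)"
    by (intro exI [of _ "\<lambda>v. L (\<chi> i. M i v)"]) (auto simp: L(2))
qed

lemma sv_holomorphic_map_on_compose:
  assumes "sv_holomorphic_map_on f T" "sv_holomorphic_map_on g S" "\<And>z. z \<in> S \<Longrightarrow> g z \<in> T"
  shows "sv_holomorphic_map_on (\<lambda>z. f (g z)) S"
  using assms(1) sv_holomorphic_on_compose [OF _ assms(2,3), of "\<lambda>z. f z $ _"]
  by (simp add: sv_holomorphic_map_on_def)

text \<open>Derivatives only depend on a neighbourhood, hence the openness of \<open>S\<close>. This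
  serves to pass from an explicit inverse to \<open>inv_into\<close>.\<close>

lemma sv_holomorphic_map_on_cong:
  assumes "open S" "\<And>z. z \<in> S \<Longrightarrow> f z = g z" "sv_holomorphic_map_on f S"
  shows "sv_holomorphic_map_on g S"
  unfolding sv_holomorphic_map_on_def sv_holomorphic_on_def
proof (intro allI ballI)
  fix i z assume z: "z \<in> S"
  then obtain L where L: "((\<lambda>z. f z $ i) has_derivative L) (at z)" "\<forall>c v. L (c *s v) = c * L v"
    using assms(3) unfolding sv_holomorphic_map_on_def sv_holomorphic_on_def by meson
  have "((\<lambda>z. g z $ i) has_derivative L) (at z)"
    by (rule has_derivative_transform_within_open [OF L(1) assms(1) z]) (simp add: assms(2))
  with L(2) show "\<exists>L. ((\<lambda>z. g z $ i) has_derivative L) (at z) \<and> (\<forall>c v. L (c *s v) = c * L v)"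
    by blast
qed

section \<open>Complex discs through the origin and the Schwarz lemma for the ball\<close>

lemma holomorphic_on_slice:
  assumes "sv_holomorphic_on f (ball 0 1)" "norm v = 1"
  shows "(\<lambda>l. f (l *s v)) holomorphic_on ball 0 1"
  unfolding holomorphic_on_def
proof
  fix l :: complex assume "l \<in> ball 0 1"
  then have "l *s v \<in> ball 0 1"
    using assms(2) by (simp add: norm_scale_vec)
  then obtain L where L: "(f has_derivative L) (at (l *s v))" "\<forall>c v. L (c *s v) = c * L v"
    using assms(1) unfolding sv_holomorphic_on_def by meson
  have "bounded_linear (\<lambda>l. l *s v)"
    by (rule bounded_linear_intro [where K = "norm v"])
      (auto simp: norm_scale_vec vec_eq_iff algebra_simps)
  then have "((\<lambda>l. l *s v) has_derivative (\<lambda>l. l *s v)) (at l)"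
    by (rule bounded_linear_imp_has_derivative)
  from diff_chain_at [OF this L(1)]
  have "((\<lambda>l. f (l *s v)) has_derivative (\<lambda>l. L (l *s v))) (at l)"
    by (simp add: o_def)
  \<comment> \<open>Complex linearity of \<open>L\<close> turns the real derivative along the disc
    into multiplication by a complex number.\<close>
  moreover have "(\<lambda>l. L (l *s v)) = (*) (L v)"
    by (auto simp: L(2))
  ultimately have "((\<lambda>l. f (l *s v)) has_field_derivative L v) (at l)"
    by (simp add: has_field_derivative_def)
  then show "(\<lambda>l. f (l *s v)) field_differentiable at l within ball 0 1"
    by (auto simp: field_differentiable_def intro: has_field_derivative_at_within)
qed

text \<open>Pairing \<open>F\<close> on a complex disc with a unit vector \<open>w\<close> gives a
  function to which the classical Schwarz lemma applies. For the bound, \<open>w\<close> points in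
  the direction of \<open>F z\<close>; for rigidity, the equality case fixes the component along
  \<open>w\<close>, and the bound leaves no room for any other component.\<close>

lemma
  assumes hol: "sv_holomorphic_map_on F (ball 0 1)" and F0: "F 0 = 0"
    and F: "\<And>z. z \<in> ball 0 1 \<Longrightarrow> F z \<in> ball 0 1"
  shows Schwarz_ball_norm_le: "z \<in> ball 0 1 \<Longrightarrow> norm (F z) \<le> norm z"
    and Schwarz_ball_rigid: "\<lbrakk>norm v = 1; cmod m < 1; m \<noteq> 0; norm (F (m *s v)) = cmod m\<rbrakk> \<Longrightarrow>
      \<exists>w. norm w = 1 \<and> (\<forall>l. cmod l < 1 \<longrightarrow> F (l *s v) = l *s w)"
proof -
  have slice_hol: "(\<lambda>l. cdot (F (l *s v)) w) holomorphic_on ball 0 1" if "norm v = 1" for v w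
    using that by (intro holomorphic_on_slice sv_holomorphic_on_cdot hol)
  have slice_0: "cdot (F (0 *s v)) w = 0" for v w
    by (simp add: F0)
  have slice_lt: "cmod (cdot (F (l *s v)) w) < 1"
    if "norm v = 1" "norm w = 1" "cmod l < 1" for v w l
  proof -
    have "norm (F (l *s v)) < 1"
      using F [of "l *s v"] that by (simp add: norm_scale_vec)
    then show ?thesis
      using norm_cdot_le [of "F (l *s v)" w] that by simp
  qed
  show le: "norm (F z) \<le> norm z" if z: "z \<in> ball 0 1" for z
  proof (cases "z = 0 \<or> F z = 0")
    case True
    then show ?thesis using F0 by auto
  next
    case False
    define v where "v = complex_of_real (1 / norm z) *s z"
    define w where "w = complex_of_real (1 / norm (F z)) *s F z"
    have v: "norm v = 1" "z = complex_of_real (norm z) *s v"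
      using False by (simp_all add: v_def norm_scale_vec norm_divide vec_eq_iff)
    have w: "norm w = 1"
      using False by (simp_all add: w_def norm_scale_vec norm_divide)
    have "cmod (cdot (F (complex_of_real (norm z) *s v)) w) \<le> cmod (complex_of_real (norm z))"
      by (rule Schwarz_Lemma(1) [OF slice_hol slice_0 slice_lt]) (use z v w in auto)
    moreover have "cmod (cdot (F z) w) = norm (F z)"
      using False
      by (simp add: w_def cdot_simps cdot_self norm_mult norm_divide power2_eq_square)
    ultimately show ?thesis
      using v(2) by simp
  qed
  show "\<exists>w. norm w = 1 \<and> (\<forall>l. cmod l < 1 \<longrightarrow> F (l *s v) = l *s w)"
    if v: "norm v = 1" and m: "cmod m < 1" "m \<noteq> 0" and eq: "norm (F (m *s v)) = cmod m"
  proof -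
    \<comment> \<open>The only possible choice, since the claim at \<open>l = m\<close> forces
      it.\<close>
    define w where "w = inverse m *s F (m *s v)"
    have w: "norm w = 1" "F (m *s v) = m *s w"
      using m eq by (simp_all add: w_def norm_scale_vec norm_inverse vec_eq_iff)
    have at_m: "cdot (F (m *s v)) w = m"
      using w by (simp add: cdot_simps cdot_self)
    \<comment> \<open>Equality at the nonzero point \<open>m\<close> makes the scalar function
      linear.\<close>
    obtain \<alpha> where \<alpha>: "\<And>l. cmod l < 1 \<Longrightarrow> cdot (F (l *s v)) w = \<alpha> * l"
      using Schwarz_Lemma(3) [OF slice_hol [OF v] slice_0 slice_lt [OF v w(1)], of 0] m at_m
      by fastforce
    with m at_m have "\<alpha> = 1"
      by simp
    have "F (l *s v) = l *s w" if l: "cmod l < 1" for l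
    proof -
      have e: "cdot (F (l *s v)) w = l"
        using \<alpha> [OF l] \<open>\<alpha> = 1\<close> by simp
      have "norm (F (l *s v)) \<le> cmod l"
        using le [of "l *s v"] l v by (simp add: norm_scale_vec)
      then have "(norm (F (l *s v)))\<^sup>2 \<le> (cmod l)\<^sup>2"
        by (simp add: power_mono)
      moreover have "cdot w (F (l *s v)) = cnj l"
        by (metis e cnj_cdot)
      moreover have "Re (l * cnj l) = (cmod l)\<^sup>2"
        by (simp add: complex_norm_square [symmetric])
      \<comment> \<open>As the component of \<open>F (l *s v)\<close> along \<open>w\<close> is
        \<open>l\<close>, the square expands to the squared norm of \<open>F (l *s v)\<close> minus
        that of \<open>l\<close>, which the bound makes nonpositive.\<close>
      ultimately have "(norm (F (l *s v) - l *s w))\<^sup>2 \<le> 0"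
        unfolding norm_sq_cdot [of "_ - _"]
        by (simp add: cdot_simps e cdot_self [of "F _"] cdot_self [of w] w(1))
      then show ?thesis
        by simp
    qed
    with w(1) show ?thesis
      by blast
  qed
qed

section \<open>Automorphisms of the ball\<close>

text \<open>The definition speaks of \<open>inv_into\<close>, which is known to agree with the
  explicit inverse \<open>h\<close> on the ball; holomorphy transfers because the ball is
  open.\<close>

lemma ball_automorphismI:
  assumes f: "sv_holomorphic_map_on f (ball 0 1)" "\<And>z. z \<in> ball 0 1 \<Longrightarrow> f z \<in> ball 0 1"
    and h: "sv_holomorphic_map_on h (ball 0 1)" "\<And>z. z \<in> ball 0 1 \<Longrightarrow> h z \<in> ball 0 1"
    and hf: "\<And>z. z \<in> ball 0 1 \<Longrightarrow> h (f z) = z" and fh: "\<And>z. z \<in> ball 0 1 \<Longrightarrow> f (h z) = z"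
  shows "ball_automorphism f"
proof -
  have bij: "bij_betw f (ball 0 1) (ball 0 1)"
    by (rule bij_betw_byWitness [where f' = h]) (use assms in auto)
  have "h z = inv_into (ball 0 1) f z" if "z \<in> ball 0 1" for z
    using inv_into_f_f [OF bij_betw_imp_inj_on [OF bij] h(2) [OF that]] fh [OF that] by simp
  then have "sv_holomorphic_map_on (inv_into (ball 0 1) f) (ball 0 1)"
    by (rule sv_holomorphic_map_on_cong [OF open_ball _ h(1)])
  with bij f(1) show ?thesis
    by (simp add: ball_automorphism_def)
qed

text \<open>The usual involution exchanging \<open>0\<close> and \<open>a\<close>. With \<open>P\<close> the orthogonal projection to the line of \<open>a\<close>,
  the familiar term \<open>P z + s (z - P z)\<close> is written as \<open>s z + (1 - s) P z\<close>, and
  \<open>(1 - s) / \<parallel>a\<parallel>\<^sup>2 = 1 / (1 + s)\<close> avoids the division by zero at \<open>a = 0\<close>.\<close>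

definition moebius :: "complex^'n \<Rightarrow> complex^'n \<Rightarrow> complex^'n" where
  "moebius a z = (let s = complex_of_real (sqrt (1 - (norm a)\<^sup>2)) in
     inverse (1 - cdot z a) *s ((1 - cdot z a / (1 + s)) *s a - s *s z))"

section \<open>Transformation law and involution property of the Moebius maps\<close>

context
  fixes a :: "complex^'n" and s :: complex
  assumes a: "a \<in> ball 0 1" and s_def: "s = complex_of_real (sqrt (1 - (norm a)\<^sup>2))"
begin

lemma norm_center_sq_lt_1: "(norm a)\<^sup>2 < 1"
  using a by (simp add: power_less_one_iff abs_square_less_1)

text \<open>This replaces the square root by an algebraic relation, so that the identities below
  become polynomial arithmetic.\<close>

lemma cdot_center: "cdot a a = 1 - s\<^sup>2"
  using norm_center_sq_lt_1 by (simp add: s_def cdot_self flip: of_real_power)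

lemma moebius_factor: "s \<noteq> 0" "1 + s \<noteq> 0" "cnj s = s"
proof -
  define x where "x = sqrt (1 - (norm a)\<^sup>2)"
  have x: "x > 0" "s = complex_of_real x" "1 + s = complex_of_real (1 + x)"
    using norm_center_sq_lt_1 by (simp_all add: x_def s_def)
  show "s \<noteq> 0" "1 + s \<noteq> 0" "cnj s = s"
    unfolding x(3) of_real_eq_0_iff using x(1,2) by auto
qed

lemma moebius_eq:
  "moebius a z = inverse (1 - cdot z a) *s ((1 - cdot z a / (1 + s)) *s a - s *s z)"
  by (simp add: moebius_def s_def Let_def)

text \<open>The transformation law of the kernel. It yields both that the ball is preserved, by
  taking \<open>w = z\<close>, and how Gram entries change.\<close>

lemma one_minus_cdot_moebius:
  assumes "z \<in> ball 0 1" "w \<in> ball 0 1"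
  shows "1 - cdot (moebius a w) (moebius a z) =
    s\<^sup>2 * (1 - cdot w z) / ((1 - cdot w a) * (1 - cdot a z))"
proof -
  let ?N = "\<lambda>z. (1 - cdot z a / (1 + s)) *s a - s *s z"
  define p q t where "p = cdot w a" and "q = cdot a z" and "t = cdot w z"
  have nz: "1 - p \<noteq> 0" "1 - q \<noteq> 0"
    unfolding p_def q_def using assms a by (blast dest: one_minus_cdot_nonzero)+
  have N: "cdot (?N w) (?N z) = (1 - p) * (1 - q) - s\<^sup>2 * (1 - t)"
  proof -
    \<comment> \<open>With the inverse named, the claim follows polynomially from
      \<open>r * (1 + s) = 1\<close>.\<close>
    define r where "r = inverse (1 + s)"
    have gen: "cdot (A *s a - s *s w) (B *s a - s *s z) =
        A * cnj B * (1 - s\<^sup>2) - A * s * q - cnj B * s * p + s\<^sup>2 * t" for A B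
      by (simp add: cdot_simps cdot_center moebius_factor(3) p_def q_def t_def power2_eq_square algebra_simps)
    have "cdot (?N w) (?N z) =
        (1 - p * r) * (1 - q * r) * (1 - s\<^sup>2) - (1 - p * r) * s * q - (1 - q * r) * s * p + s\<^sup>2 * t"
      unfolding gen by (simp add: cnj_cdot moebius_factor(3) r_def divide_inverse flip: p_def q_def)
    moreover have "r * (1 + s) = 1"
      using moebius_factor(2) by (simp add: r_def)
    ultimately show ?thesis
      by algebra
  qed
  have "cnj (inverse d) * (inverse b * n) = n / (b * cnj d)" for b d n
    by (simp add: divide_inverse)
  then have "cdot (moebius a w) (moebius a z) = cdot (?N w) (?N z) / ((1 - p) * (1 - q))"
    by (simp only: moebius_eq cdot_scale_left cdot_scale_right complex_cnj_diff complex_cnj_one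
        cnj_cdot p_def q_def)
  then show ?thesis
    using nz unfolding N unfolding p_def [symmetric] q_def [symmetric] t_def [symmetric]
    by (simp add: diff_divide_distrib)
qed

lemma moebius_in_ball:
  assumes z: "z \<in> ball 0 1"
  shows "moebius a z \<in> ball 0 1"
proof -
  have "complex_of_real (1 - (norm (moebius a z))\<^sup>2) =
      complex_of_real ((1 - (norm a)\<^sup>2) * (1 - (norm z)\<^sup>2) / (cmod (1 - cdot z a))\<^sup>2)"
  proof -
    have "(1 - cdot z a) * (1 - cdot a z) = complex_of_real ((cmod (1 - cdot z a))\<^sup>2)"
      by (simp only: complex_norm_square complex_cnj_diff complex_cnj_one cnj_cdot)
    moreover have "s\<^sup>2 = 1 - cdot a a"
      by (simp add: cdot_center)
    ultimately show ?thesis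
      using one_minus_cdot_moebius [OF z z]
      by (simp only: cdot_self of_real_diff of_real_divide of_real_mult of_real_1)
  qed
  moreover have "(1 - (norm a)\<^sup>2) * (1 - (norm z)\<^sup>2) / (cmod (1 - cdot z a))\<^sup>2 > 0"
    using norm_center_sq_lt_1 z one_minus_cdot_nonzero [OF z a]
    by (intro divide_pos_pos mult_pos_pos) (auto simp: abs_square_less_1)
  ultimately have "(norm (moebius a z))\<^sup>2 < 1"
    unfolding of_real_eq_iff by linarith
  then show ?thesis
    by (simp add: abs_square_less_1)
qed

lemma moebius_involution:
  assumes z: "z \<in> ball 0 1"
  shows "moebius a (moebius a z) = z"
proof -
  define l where "l = cdot z a"
  have nz: "1 - l \<noteq> 0"
    unfolding l_def using z a by (rule one_minus_cdot_nonzero)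
  have m: "moebius a z = inverse (1 - l) *s ((1 - l / (1 + s)) *s a - s *s z)"
    by (simp add: moebius_eq l_def)
  \<comment> \<open>The outer application of \<open>moebius a\<close> needs only this scalar besides
    the vector itself.\<close>
  have c: "cdot (moebius a z) a = (1 - s\<^sup>2 - l) / (1 - l)"
  proof -
    have "(1 - l / (1 + s)) * (1 - s\<^sup>2) - s * l = 1 - s\<^sup>2 - l"
      using moebius_factor(2) by (simp add: field_simps power2_eq_square)
    moreover have "cdot (moebius a z) a = inverse (1 - l) * ((1 - l / (1 + s)) * (1 - s\<^sup>2) - s * l)"
      by (simp only: m cdot_scale_left cdot_diff_left cdot_center l_def)
    ultimately show ?thesis
      by (simp add: divide_inverse mult.commute)
  qed
  have i: "inverse (1 - (1 - s\<^sup>2 - l) / (1 - l)) = (1 - l) / s\<^sup>2"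
    using nz moebius_factor by (simp add: field_simps)
  show ?thesis
    unfolding moebius_eq [of "moebius a z"] c i unfolding m
  proof (subst vec_eq_iff, rule allI, unfold vector_smult_component vector_minus_component)
    fix i
    \<comment> \<open>The three inverses become unknowns subject to one polynomial relation each,
      which imply the identity in every coordinate.\<close>
    define r I S where "r = inverse (1 + s)" and "I = inverse (1 - l)" and "S = inverse (s\<^sup>2)"
    have "r * (1 + s) = 1" "I * (1 - l) = 1" "S * s\<^sup>2 = 1"
      using nz moebius_factor by (simp_all add: r_def I_def S_def)
    then have "(1 - l) * S * ((1 - (1 - s\<^sup>2 - l) * I * r) * a $ i -
        s * (I * ((1 - l * r) * a $ i - s * z $ i))) = z $ i"
      by algebra
    then show "(1 - l) / s\<^sup>2 * ((1 - (1 - s\<^sup>2 - l) / (1 - l) / (1 + s)) * a $ i -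
        s * (inverse (1 - l) * ((1 - l / (1 + s)) * a $ i - s * z $ i))) = z $ i"
      by (simp add: r_def I_def S_def divide_inverse mult_ac)
  qed
qed

lemma moebius_self: "moebius a a = 0"
proof -
  have "1 - (1 - s\<^sup>2) / (1 + s) = s"
    using moebius_factor(2) by (simp add: field_simps power2_eq_square)
  then show ?thesis
    by (simp add: moebius_eq cdot_center)
qed

lemma moebius_zero: "moebius a 0 = a"
  by (simp add: moebius_eq vec_eq_iff)

lemma sv_holomorphic_moebius: "sv_holomorphic_map_on (moebius a) (ball 0 1)"
proof -
  \<comment> \<open>Differences and quotients are written as sums and products with constants to
    match the closure rules.\<close>
  have "sv_holomorphic_on (\<lambda>z. inverse (1 + - 1 * cdot z a) *
      ((1 + cdot z a * (- inverse (1 + s))) * a $ i + - s * z $ i)) (ball 0 1)" for i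
    using one_minus_cdot_nonzero [OF _ a]
    by (intro sv_holomorphic_on_mult sv_holomorphic_on_inverse sv_holomorphic_on_add
        sv_holomorphic_on_const sv_holomorphic_on_nth sv_holomorphic_on_cdot
        sv_holomorphic_map_on_ident) auto
  then show ?thesis
    by (simp add: sv_holomorphic_map_on_def moebius_eq divide_inverse algebra_simps)
qed

end

section \<open>Geodesics as Moebius images of real diameters\<close>

lemma ball_automorphism_maps:
  assumes "ball_automorphism f" "z \<in> ball 0 1"
  shows "f z \<in> ball 0 1" "inv_into (ball 0 1) f z \<in> ball 0 1"
    "inv_into (ball 0 1) f (f z) = z" "f (inv_into (ball 0 1) f z) = z"
proof -
  have bij: "bij_betw f (ball 0 1) (ball 0 1)"
    using assms(1) by (simp add: ball_automorphism_def)
  show "f z \<in> ball 0 1" "inv_into (ball 0 1) f z \<in> ball 0 1"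
    using bij_betw_apply [OF bij assms(2)] bij_betw_apply [OF bij_betw_inv_into [OF bij] assms(2)] .
  show "inv_into (ball 0 1) f (f z) = z" "f (inv_into (ball 0 1) f z) = z"
    using bij_betw_inv_into_left [OF bij assms(2)] bij_betw_inv_into_right [OF bij assms(2)] .
qed

lemma norm_axis_complex: "norm (axis i (1 :: complex)) = 1"
  by (intro norm_Basis) simp

text \<open>After moving \<open>f 0\<close> to the origin, the Schwarz lemma applies to the automorphism and to its
  inverse, so the automorphism is isometric on every disc through the origin.\<close>

lemma geodesic_through_moebius:
  fixes f :: "(complex, 'n::{finite,linorder}) vec \<Rightarrow> (complex, 'n) vec"
  assumes f: "ball_automorphism f"
  obtains w where "norm w = 1"
    "\<And>t. \<bar>t\<bar> < 1 \<Longrightarrow> f (axis (Min UNIV) (of_real t)) = moebius (f 0) (of_real t *s w)"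
proof -
  define a where "a = f 0"
  define e :: "(complex, 'n) vec" where "e = axis (Min UNIV) 1"
  have e: "norm e = 1" "of_real t *s e = axis (Min UNIV) (of_real t)" for t
    by (auto simp: e_def norm_axis_complex) (auto simp: axis_def vec_eq_iff)
  have a: "a \<in> ball 0 1"
    unfolding a_def by (rule ball_automorphism_maps(1) [OF f]) simp
  note [simp del] = mem_ball_0
  \<comment> \<open>\<open>F\<close> is \<open>f\<close> followed by the Moebius map exchanging
    \<open>f 0\<close> and the origin, and \<open>G\<close> is its inverse; both fix the
    origin.\<close>
  define F where "F = (\<lambda>z. moebius a (f z))"
  define G where "G = (\<lambda>z. inv_into (ball 0 1) f (moebius a z))"
  have hol: "sv_holomorphic_map_on f (ball 0 1)"
    "sv_holomorphic_map_on (inv_into (ball 0 1) f) (ball 0 1)"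
    using f by (auto simp: ball_automorphism_def)
  have F: "sv_holomorphic_map_on F (ball 0 1)" "F 0 = 0"
    "\<And>z. z \<in> ball 0 1 \<Longrightarrow> F z \<in> ball 0 1"
    unfolding F_def
    using sv_holomorphic_map_on_compose [OF sv_holomorphic_moebius [OF a refl] hol(1)]
      moebius_self [OF a refl] moebius_in_ball [OF a refl] ball_automorphism_maps [OF f]
    by (auto simp flip: a_def)
  have "inv_into (ball 0 1) f a = 0"
    unfolding a_def by (rule ball_automorphism_maps(3) [OF f]) simp
  then have G: "sv_holomorphic_map_on G (ball 0 1)" "G 0 = 0"
    "\<And>z. z \<in> ball 0 1 \<Longrightarrow> G z \<in> ball 0 1"
    unfolding G_def
    using sv_holomorphic_map_on_compose [OF hol(2) sv_holomorphic_moebius [OF a refl]]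
      moebius_zero [OF a refl] moebius_in_ball [OF a refl] ball_automorphism_maps [OF f]
    by auto
  have GF: "G (F z) = z" if "z \<in> ball 0 1" for z
    unfolding F_def G_def
    using that
    by (simp only: ball_automorphism_maps(1,3) [OF f that] moebius_involution [OF a refl])
  have half: "(1 / 2 :: complex) *s e \<in> ball 0 1"
    using e(1) by (simp add: norm_scale_vec norm_divide mem_ball_0)
  \<comment> \<open>Neither \<open>F\<close> nor its left inverse \<open>G\<close> increases norms,
    so the norm of this point is preserved. Any nonzero point of the disc spanned by
    \<open>e\<close> would do.\<close>
  have "norm (F ((1 / 2) *s e)) = cmod (1 / 2)"
    using Schwarz_ball_norm_le [OF F half] Schwarz_ball_norm_le [OF G F(3) [OF half]]
      GF [OF half] e(1)
    by (simp add: norm_scale_vec)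
  then obtain w where w: "norm w = 1" "\<And>l. cmod l < 1 \<Longrightarrow> F (l *s e) = l *s w"
    using Schwarz_ball_rigid [OF F e(1), of "1 / 2"] by (auto simp: norm_divide)
  have "f (axis (Min UNIV) (of_real t)) = moebius (f 0) (of_real t *s w)" if "\<bar>t\<bar> < 1" for t
  proof -
    have "of_real t *s e \<in> ball 0 1"
      using that e(1) by (simp add: norm_scale_vec mem_ball_0)
    then have "moebius a (F (of_real t *s e)) = f (of_real t *s e)"
      unfolding F_def
      by (intro moebius_involution [OF a refl] ball_automorphism_maps(1) [OF f])
    then show ?thesis
      using that w(2) [of "of_real t"] by (simp add: e(2) a_def)
  qed
  with w(1) show thesis
    by (rule that)
qed

text \<open>The unitary reflection in \<open>w - e\<close> maps the unit vector \<open>e\<close> to \<open>w\<close>. For \<open>w = e\<close> the junk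
  value \<open>0 / 0 = 0\<close> makes it the identity, as it should be.\<close>

lemma unit_ray_automorphism:
  fixes e w :: "complex^'n"
  assumes "norm e = 1" "norm w = 1"
  obtains V where "sv_holomorphic_map_on V (ball 0 1)" "\<And>z. z \<in> ball 0 1 \<Longrightarrow> V z \<in> ball 0 1"
    "ball_automorphism V" "\<And>t. V (t *s e) = t *s w"
proof -
  define u where "u = w - e"
  define c where "c = inverse (cdot e u)"
  \<comment> \<open>\<open>V (cnj c)\<close> is the adjoint of \<open>V c\<close> and will be its
    inverse.\<close>
  define V where "V = (\<lambda>c z. z + (c * cdot z u) *s u)"
  have ee: "cdot e e = 1" "cdot w w = 1"
    using assms by (simp_all add: cdot_self)
  have eu: "cdot e u = cdot e w - 1"
    by (simp add: u_def cdot_simps ee)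
  have uu: "cdot u u = - (cdot e u) - cnj (cdot e u)"
    by (simp add: u_def cdot_simps ee cnj_cdot)
  have u0: "u = 0" if "cdot e u = 0"
    using uu that by (simp add: cdot_self)
  \<comment> \<open>This scalar identity is the unitarity of \<open>V c\<close>: it makes both
    compositions with the adjoint the identity and gives norm preservation.\<close>
  have key: "c + cnj c + c * cnj c * cdot u u = 0"
    by (cases "cdot e u = 0") (simp_all add: c_def uu field_simps)
  have inv: "V (cnj c) (V c z) = z" "V c (V (cnj c) z) = z" for z
  proof -
    have "V (cnj c) (V c z) = z + ((c + cnj c + c * cnj c * cdot u u) * cdot z u) *s u"
      "V c (V (cnj c) z) = z + ((c + cnj c + c * cnj c * cdot u u) * cdot z u) *s u"
      by (simp_all add: V_def cdot_simps vec_eq_iff algebra_simps)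
    then show "V (cnj c) (V c z) = z" "V c (V (cnj c) z) = z"
      by (simp_all add: key)
  qed
  have iso: "norm (V b z) = norm z" if "b = c \<or> b = cnj c" for b z
  proof -
    have "cdot (V b z) (V b z) =
        cdot z z + (b + cnj b + b * cnj b * cdot u u) * (cdot z u * cdot u z)"
      by (simp add: V_def cdot_simps cnj_cdot algebra_simps)
    moreover have "b + cnj b + b * cnj b * cdot u u = 0"
      using key that by (auto simp: add.commute mult.commute)
    ultimately have "(norm (V b z))\<^sup>2 = (norm z)\<^sup>2"
      by (simp add: norm_sq_cdot)
    then show ?thesis
      by simp
  qed
  have hol: "sv_holomorphic_map_on (V b) S" for b S
    unfolding V_def sv_holomorphic_map_on_def
    by (auto intro!: sv_holomorphic_on_mult sv_holomorphic_on_add sv_holomorphic_on_const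
        sv_holomorphic_on_nth sv_holomorphic_on_cdot sv_holomorphic_map_on_ident)
  have ball: "V c z \<in> ball 0 1" "V (cnj c) z \<in> ball 0 1" if "z \<in> ball 0 1" for z
    using that by (simp_all add: iso)
  have "ball_automorphism (V c)"
    using hol ball inv by (intro ball_automorphismI [of "V c" "V (cnj c)"]) auto
  moreover have "V c (t *s e) = t *s w" for t
  proof (cases "cdot e u = 0")
    case True
    then show ?thesis
      using u0 by (simp add: V_def u_def)
  next
    case False
    then show ?thesis
      by (simp add: V_def c_def cdot_simps) (simp add: u_def vec_eq_iff algebra_simps)
  qed
  ultimately show thesis
    using that hol ball by blast
qed

text \<open>A unitary map carries the first axis to the direction \<open>w\<close>; followed by
  \<open>moebius a\<close>, it is an automorphism whose image of the model geodesic contains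
  \<open>X\<close>.\<close>

lemma lies_in_geodesic_moebius:
  fixes a w :: "(complex, 'n::{finite,linorder}) vec"
  assumes a: "a \<in> ball 0 1" and w: "norm w = 1"
    and X: "\<And>p. p \<in> X \<Longrightarrow> \<exists>t. \<bar>t\<bar> < 1 \<and> p = moebius a (of_real t *s w)"
  shows "lies_in_geodesic X"
proof -
  define e :: "(complex, 'n) vec" where "e = axis (Min UNIV) 1"
  have e: "norm e = 1" "axis (Min UNIV) (of_real t) = of_real t *s e" for t
    by (auto simp: e_def norm_axis_complex) (auto simp: axis_def vec_eq_iff)
  obtain V where V: "sv_holomorphic_map_on V (ball 0 1)"
    "\<And>z. z \<in> ball 0 1 \<Longrightarrow> V z \<in> ball 0 1" "ball_automorphism V" "\<And>t. V (t *s e) = t *s w"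
    by (rule unit_ray_automorphism [OF e(1) w]) blast
  note M = sv_holomorphic_moebius [OF a refl] moebius_in_ball [OF a refl]
    moebius_involution [OF a refl]
  have invV: "sv_holomorphic_map_on (inv_into (ball 0 1) V) (ball 0 1)"
    using V(3) by (simp add: ball_automorphism_def)
  have aut: "ball_automorphism (\<lambda>z. moebius a (V z))"
  proof (rule ball_automorphismI [where h = "\<lambda>z. inv_into (ball 0 1) V (moebius a z)"])
    show "sv_holomorphic_map_on (\<lambda>z. moebius a (V z)) (ball 0 1)"
      by (rule sv_holomorphic_map_on_compose [OF M(1) V(1,2)])
    show "sv_holomorphic_map_on (\<lambda>z. inv_into (ball 0 1) V (moebius a z)) (ball 0 1)"
      by (rule sv_holomorphic_map_on_compose [OF invV M(1,2)])
    fix z :: "(complex, 'n) vec" assume z: "z \<in> ball 0 1"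
    note V' = ball_automorphism_maps [OF V(3)]
    show "moebius a (V z) \<in> ball 0 1"
      by (rule M(2) [OF V(2) [OF z]])
    show "inv_into (ball 0 1) V (moebius a z) \<in> ball 0 1"
      by (rule V'(2) [OF M(2) [OF z]])
    show "inv_into (ball 0 1) V (moebius a (moebius a (V z))) = z"
      by (simp only: M(3) [OF V(2) [OF z]] V'(3) [OF z])
    show "moebius a (V (inv_into (ball 0 1) V (moebius a z))) = z"
      by (simp only: V'(4) [OF M(2) [OF z]] M(3) [OF z])
  qed
  have "X \<subseteq> (\<lambda>z. moebius a (V z)) ` {axis (Min UNIV) (of_real t) | t::real. - 1 < t \<and> t < 1}"
  proof
    fix p assume "p \<in> X"
    then obtain t where t: "\<bar>t\<bar> < 1" "p = moebius a (of_real t *s w)"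
      using X by blast
    then have "p = moebius a (V (axis (Min UNIV) (of_real t)))" "- 1 < t" "t < 1"
      by (simp_all only: e(2) V(4) abs_less_iff) linarith
    then show "p \<in> (\<lambda>z. moebius a (V z)) ` {axis (Min UNIV) (of_real t) | t::real. - 1 < t \<and> t < 1}"
      by blast
  qed
  moreover have "geodesic ((\<lambda>z. moebius a (V z)) ` {axis (Min UNIV) (of_real t) | t::real. - 1 < t \<and> t < 1})"
    unfolding geodesic_def by (rule exI [of _ "\<lambda>z. moebius a (V z)"]) (simp add: aut)
  ultimately show ?thesis
    unfolding lies_in_geodesic_def by blast
qed

section \<open>The invariants of a triple\<close>

definition da_gram :: "complex^'n \<Rightarrow> complex^'n \<Rightarrow> complex" where
  "da_gram z w = inverse (1 - cdot w z)"

lemma (in drury_arveson_space) kernel_gram_eq: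
  assumes "z \<in> ball 0 1" "w \<in> ball 0 1"
  shows "kernel_gram ip z w = da_gram z w"
  using reproducing [OF kernel_mem [OF assms(1)] assms(2)] assms(2)
  by (simp add: kernel_gram_def da_kernel_def da_gram_def)

lemma cnj_da_gram: "cnj (da_gram z w) = da_gram w z"
  by (simp add: da_gram_def cnj_cdot)

text \<open>The transformation law splits symmetrically because \<open>s\<close> is real: one may
  take \<open>\<gamma> z = (1 - cdot z a) / s\<close>.\<close>

lemma da_gram_moebius:
  fixes a :: "complex^'n"
  assumes a: "a \<in> ball 0 1"
  obtains \<gamma> :: "complex^'n \<Rightarrow> complex"
  where "\<And>z. z \<in> ball 0 1 \<Longrightarrow> \<gamma> z \<noteq> 0"
    "\<And>z w. \<lbrakk>z \<in> ball 0 1; w \<in> ball 0 1\<rbrakk> \<Longrightarrow>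
      da_gram (moebius a z) (moebius a w) = \<gamma> w * cnj (\<gamma> z) * da_gram z w"
proof -
  define s where "s = complex_of_real (sqrt (1 - (norm a)\<^sup>2))"
  define \<gamma> where "\<gamma> = (\<lambda>z. (1 - cdot z a) / s)"
  note s = moebius_factor [OF a s_def]
  have "\<gamma> z \<noteq> 0" if "z \<in> ball 0 1" for z
    using one_minus_cdot_nonzero [OF that a] s by (simp add: \<gamma>_def)
  moreover have "da_gram (moebius a z) (moebius a w) = \<gamma> w * cnj (\<gamma> z) * da_gram z w"
    if "z \<in> ball 0 1" "w \<in> ball 0 1" for z w
    unfolding da_gram_def one_minus_cdot_moebius [OF a s_def that]
    using s by (simp add: \<gamma>_def cnj_cdot divide_simps power2_eq_square)
  ultimately show thesis
    by (rule that)
qed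

definition mq_entry :: "complex^'n \<Rightarrow> complex^'n \<Rightarrow> complex^'n \<Rightarrow> complex" where
  "mq_entry p q t = 1 - (da_gram q p * da_gram p t) / (da_gram q t * da_gram p p)"

text \<open>The second conjunct is the vanishing of the 2 by 2 determinant of \<open>MQ1\<close>
  based at \<open>p\<close>. Both criteria of the theorem reduce to this predicate.\<close>

definition geodesic_triple :: "complex^'n \<Rightarrow> complex^'n \<Rightarrow> complex^'n \<Rightarrow> bool" where
  "geodesic_triple p q t \<longleftrightarrow>
     Arg (da_gram p q * da_gram q t * da_gram t p) = 0 \<and>
     mq_entry p q q * mq_entry p t t = mq_entry p q t * mq_entry p t q"

text \<open>The same factors \<open>\<gamma>\<close> and conjugates appear in numerator and
  denominator.\<close>

lemma mq_entry_moebius: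
  assumes "a \<in> ball 0 1" "p \<in> ball 0 1" "q \<in> ball 0 1" "t \<in> ball 0 1"
  shows "mq_entry (moebius a p) (moebius a q) (moebius a t) = mq_entry p q t"
proof -
  obtain \<gamma> where \<gamma>: "\<And>z. z \<in> ball 0 1 \<Longrightarrow> \<gamma> z \<noteq> 0"
    "\<And>z w. \<lbrakk>z \<in> ball 0 1; w \<in> ball 0 1\<rbrakk> \<Longrightarrow>
      da_gram (moebius a z) (moebius a w) = \<gamma> w * cnj (\<gamma> z) * da_gram z w"
    by (rule da_gram_moebius [OF assms(1)]) blast
  have "\<gamma> p \<noteq> 0" "\<gamma> q \<noteq> 0" "\<gamma> t \<noteq> 0"
    using \<gamma>(1) assms by auto
  then show ?thesis
    using assms by (simp add: mq_entry_def \<gamma>(2) del: mem_ball_0)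
qed

lemma Arg_eq_0_mult_pos:
  assumes "c > 0"
  shows "Arg (complex_of_real c * z) = 0 \<longleftrightarrow> Arg z = 0"
  using assms by (simp add: Arg_eq_0 complex_is_Real_iff zero_le_mult_iff)

text \<open>In the cyclic product each \<open>\<gamma>\<close> meets its conjugate, so the product
  is only scaled by a positive real number.\<close>

lemma geodesic_triple_moebius:
  assumes "a \<in> ball 0 1" "p \<in> ball 0 1" "q \<in> ball 0 1" "t \<in> ball 0 1"
  shows "geodesic_triple (moebius a p) (moebius a q) (moebius a t) \<longleftrightarrow> geodesic_triple p q t"
proof -
  obtain \<gamma> where \<gamma>: "\<And>z. z \<in> ball 0 1 \<Longrightarrow> \<gamma> z \<noteq> 0"
    "\<And>z w. \<lbrakk>z \<in> ball 0 1; w \<in> ball 0 1\<rbrakk> \<Longrightarrow>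
      da_gram (moebius a z) (moebius a w) = \<gamma> w * cnj (\<gamma> z) * da_gram z w"
    by (rule da_gram_moebius [OF assms(1)]) blast
  define c where "c = (cmod (\<gamma> p * \<gamma> q * \<gamma> t))\<^sup>2"
  have c: "c > 0"
    using \<gamma>(1) assms by (simp add: c_def del: mem_ball_0)
  have "complex_of_real c = \<gamma> p * \<gamma> q * \<gamma> t * cnj (\<gamma> p * \<gamma> q * \<gamma> t)"
    unfolding c_def by (simp only: complex_norm_square)
  then have "da_gram (moebius a p) (moebius a q) * da_gram (moebius a q) (moebius a t) *
      da_gram (moebius a t) (moebius a p) =
      complex_of_real c * (da_gram p q * da_gram q t * da_gram t p)"
    using assms by (simp add: \<gamma>(2) del: mem_ball_0)
  then show ?thesis
    unfolding geodesic_triple_def using assms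
    by (simp add: mq_entry_moebius Arg_eq_0_mult_pos [OF c] del: mem_ball_0)
qed

text \<open>With \<open>p\<close> moved to the origin, every kernel value involving the base point
  is \<open>1\<close>. This identifies the entry as a squared pseudohyperbolic distance.\<close>

lemma mq_entry_diag:
  assumes p: "p \<in> ball 0 1" and q: "q \<in> ball 0 1"
  shows "mq_entry p q q = complex_of_real ((norm (moebius p q))\<^sup>2)"
proof -
  have "mq_entry p q q = mq_entry 0 (moebius p q) (moebius p q)"
    using mq_entry_moebius [OF p p q q] by (simp add: moebius_self [OF p refl])
  also have "\<dots> = complex_of_real ((norm (moebius p q))\<^sup>2)"
    by (simp add: mq_entry_def da_gram_def cdot_self divide_inverse)
  finally show ?thesis .
qed

lemma moebius_nonzero:
  assumes p: "p \<in> ball 0 1" and q: "q \<in> ball 0 1" and "p \<noteq> q"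
  shows "moebius p q \<noteq> 0"
  using moebius_involution [OF p refl q] moebius_zero [OF p refl] assms(3) by auto

text \<open>On a diameter all Gram entries are positive reals, and the entries of \<open>MQ1\<close>
  factor into a part depending on the row and a part depending on the column, so the rank is at most
  one.\<close>

lemma geodesic_triple_ray:
  assumes w: "norm w = 1" and t: "\<bar>t1\<bar> < 1" "\<bar>t2\<bar> < 1" "\<bar>t3\<bar> < 1"
  shows "geodesic_triple (complex_of_real t1 *s w) (of_real t2 *s w) (of_real t3 *s w)"
proof -
  have pos: "1 - x * y > 0" if "\<bar>x\<bar> < 1" "\<bar>y\<bar> < 1" for x y :: real
  proof -
    have "\<bar>x\<bar> * \<bar>y\<bar> < 1 * 1"
      using that by (intro mult_strict_mono') auto
    then show ?thesis
      by (simp flip: abs_mult)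
  qed
  have g: "da_gram (of_real x *s w) (of_real y *s w) = complex_of_real (inverse (1 - x * y))" for x y
    by (simp add: da_gram_def cdot_simps cdot_self w mult.commute)
  define m where "m x y = 1 - (1 - x * y) * (1 - t1 * t1) / ((1 - x * t1) * (1 - t1 * y))" for x y
  have m_eq: "mq_entry (of_real t1 *s w) (of_real x *s w) (of_real y *s w) = complex_of_real (m x y)"
    for x y
    unfolding mq_entry_def g m_def by (simp add: divide_inverse)
  have m: "m x y = (x - t1) * (y - t1) / ((1 - x * t1) * (1 - t1 * y))"
    if "\<bar>x\<bar> < 1" "\<bar>y\<bar> < 1" for x y
  proof -
    have "m x y = ((1 - x * t1) * (1 - t1 * y) - (1 - x * y) * (1 - t1 * t1)) /
        ((1 - x * t1) * (1 - t1 * y))"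
      using pos [OF that(1) t(1)] pos [OF t(1) that(2)] by (simp add: m_def diff_divide_distrib)
    then show ?thesis
      by (simp add: algebra_simps)
  qed
  have "m t2 t2 * m t3 t3 = m t2 t3 * m t3 t2"
    using t by (simp add: m mult_ac)
  moreover have "inverse (1 - t1 * t2) * inverse (1 - t2 * t3) * inverse (1 - t3 * t1) > 0"
    using t by (intro mult_pos_pos positive_imp_inverse_positive pos) auto
  moreover have "Arg (complex_of_real c) = 0" if "c > 0" for c
    using that by (simp add: Arg_eq_0)
  ultimately show ?thesis
    unfolding geodesic_triple_def m_eq g of_real_mult [symmetric] by (simp only: simp_thms)
qed

text \<open>Based at the origin, \<open>mq_entry\<close> is just the inner product, so the
  determinant condition is equality in Cauchy-Schwarz, while the \<open>Arg\<close> condition makes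
  the proportionality factor real.\<close>

lemma geodesic_triple_origin:
  assumes y: "y \<in> ball 0 1" "y \<noteq> 0" and z: "z \<in> ball 0 1" and tr: "geodesic_triple 0 y z"
  shows "\<exists>t. z = complex_of_real t *s y"
proof -
  have "Arg (inverse (1 - cdot z y)) = 0"
    using tr by (simp add: geodesic_triple_def da_gram_def)
  then have "inverse (1 - cdot z y) \<in> \<real>"
    by (simp add: Arg_eq_0)
  then have "1 - cdot z y \<in> \<real>"
    by (metis Reals_inverse inverse_inverse_eq)
  from Reals_diff [OF Reals_1 this]
  obtain c where c: "cdot z y = complex_of_real c"
    by (auto elim: Reals_cases)
  then have c': "cdot y z = complex_of_real c"
    using cnj_cdot [of z y] by simp
  have "complex_of_real ((norm y)\<^sup>2 * (norm z)\<^sup>2) = complex_of_real (c * c)"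
    using tr by (simp add: geodesic_triple_def mq_entry_def da_gram_def cdot_self c c' divide_inverse)
  then have eq: "(norm y)\<^sup>2 * (norm z)\<^sup>2 = c\<^sup>2"
    unfolding of_real_eq_iff by (simp add: power2_eq_square)
  \<comment> \<open>The coefficient of the orthogonal projection of \<open>z\<close> to the line of
    \<open>y\<close>.\<close>
  define t where "t = c / (norm y)\<^sup>2"
  have "(norm (z - complex_of_real t *s y))\<^sup>2 = (norm z)\<^sup>2 - 2 * t * c + t\<^sup>2 * (norm y)\<^sup>2"
    unfolding norm_sq_cdot [of "_ - _"] cdot_simps unfolding c c' cdot_self
    by (simp add: power2_eq_square algebra_simps)
  also have "\<dots> = 0"
    using eq y(2) by (simp add: t_def field_simps power2_eq_square)
  finally show ?thesis
    by auto
qed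

section \<open>From triples to the whole set\<close>

lemma geodesic_triple_if_lies_in_geodesic:
  fixes X :: "(complex, 'n::{finite,linorder}) vec set"
  assumes "lies_in_geodesic X" "p \<in> X" "q \<in> X" "t \<in> X"
  shows "geodesic_triple p q t"
proof -
  obtain f :: "(complex, 'n) vec \<Rightarrow> (complex, 'n) vec" where f: "ball_automorphism f"
    "X \<subseteq> f ` {axis (Min UNIV) (of_real t) | t::real. - 1 < t \<and> t < 1}"
    using assms(1) unfolding lies_in_geodesic_def geodesic_def by blast
  obtain w where w: "norm w = 1"
    "\<And>t. \<bar>t\<bar> < 1 \<Longrightarrow> f (axis (Min UNIV) (of_real t)) = moebius (f 0) (of_real t *s w)"
    by (rule geodesic_through_moebius [OF f(1)]) blast
  have a: "f 0 \<in> ball 0 1"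
    by (rule ball_automorphism_maps(1) [OF f(1)]) simp
  \<comment> \<open>All of \<open>X\<close> comes from one diameter under one Moebius map, so
    invariance reduces the claim to \<open>geodesic_triple_ray\<close>.\<close>
  have "\<exists>t. \<bar>t\<bar> < 1 \<and> x = moebius (f 0) (of_real t *s w)" if "x \<in> X" for x
    using f(2) that w(2) by (fastforce simp: abs_less_iff)
  then obtain t1 t2 t3 where
    "\<bar>t1\<bar> < 1" "p = moebius (f 0) (of_real t1 *s w)"
    "\<bar>t2\<bar> < 1" "q = moebius (f 0) (of_real t2 *s w)"
    "\<bar>t3\<bar> < 1" "t = moebius (f 0) (of_real t3 *s w)"
    using assms(2-4) by meson
  moreover have "complex_of_real t *s w \<in> ball 0 1" if "\<bar>t\<bar> < 1" for t
    using that w(1) by (simp add: norm_scale_vec)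
  ultimately show ?thesis
    using geodesic_triple_ray [OF w(1)] by (simp add: geodesic_triple_moebius [OF a] del: mem_ball_0)
qed

text \<open>Once \<open>p\<close> sits at the origin, \<open>q\<close> fixes a direction, and each
  triple with a further point puts that point on the same diameter. Hence triples containing this
  one pair suffice.\<close>

lemma lies_in_geodesic_if_geodesic_triples:
  fixes X :: "(complex, 'n::{finite,linorder}) vec set"
  assumes X: "X \<subseteq> ball 0 1" and p: "p \<in> X" and q: "q \<in> X" "q \<noteq> p"
    and tr: "\<And>t. t \<in> X - {p, q} \<Longrightarrow> geodesic_triple p q t"
  shows "lies_in_geodesic X"
proof -
  have pq: "p \<in> ball 0 1" "q \<in> ball 0 1"
    using X p q by auto
  define y where "y = moebius p q"
  have y: "y \<in> ball 0 1" "y \<noteq> 0"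
    unfolding y_def using moebius_in_ball [OF pq(1) refl pq(2)] moebius_nonzero [OF pq q(2) [symmetric]]
    by auto
  define w where "w = complex_of_real (1 / norm y) *s y"
  have w: "norm w = 1" "y = complex_of_real (norm y) *s w"
    using y by (simp_all add: w_def norm_scale_vec norm_divide vec_eq_iff)
  have "\<exists>t. \<bar>t\<bar> < 1 \<and> x = moebius p (of_real t *s w)" if x: "x \<in> X" for x
  proof -
    have xb: "x \<in> ball 0 1"
      using X x by auto
    have "\<exists>t. moebius p x = complex_of_real t *s y"
    proof (cases "x = p \<or> x = q")
      case True
      then show ?thesis
      proof
        assume "x = p"
        then show ?thesis
          by (intro exI [of _ 0]) (simp add: moebius_self [OF pq(1) refl])
      qed (auto simp: y_def intro: exI [of _ 1])
    next
      case False
      then have "geodesic_triple (moebius p p) y (moebius p x)"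
        unfolding y_def using tr x pq xb by (simp add: geodesic_triple_moebius del: mem_ball_0)
      then show ?thesis
        using geodesic_triple_origin [OF y moebius_in_ball [OF pq(1) refl xb]]
        by (simp add: moebius_self [OF pq(1) refl])
    qed
    then obtain t where "moebius p x = complex_of_real t *s y"
      by blast
    then have t: "moebius p x = complex_of_real (t * norm y) *s w"
      using w(2) by (metis of_real_mult vector_smult_assoc)
    \<comment> \<open>The parameter lies in the open interval because the image of \<open>x\<close>
      lies in the ball.\<close>
    have "\<bar>t * norm y\<bar> < 1"
      using moebius_in_ball [OF pq(1) refl xb] unfolding t
      by (simp add: norm_scale_vec w(1) abs_mult norm_mult)
    moreover have "x = moebius p (complex_of_real (t * norm y) *s w)"
      using moebius_involution [OF pq(1) refl xb] t by simp
    ultimately show ?thesis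
      by blast
  qed
  then show ?thesis
    by (rule lies_in_geodesic_moebius [OF pq(1) w(1)])
qed

text \<open>Any diameter moved to \<open>p\<close> will do; \<open>axis undefined 1\<close> is an
  arbitrary unit vector.\<close>

lemma lies_in_geodesic_at_most_one_point:
  fixes p :: "(complex, 'n::{finite,linorder}) vec"
  assumes "X \<subseteq> {p}" "p \<in> ball 0 1"
  shows "lies_in_geodesic X"
proof (rule lies_in_geodesic_moebius [OF assms(2), of "axis undefined 1"])
  fix x assume "x \<in> X"
  then show "\<exists>t. \<bar>t\<bar> < 1 \<and> x = moebius p (of_real t *s axis undefined 1)"
    using assms by (intro exI [of _ 0]) (auto simp: moebius_zero)
qed (simp add: norm_axis_complex)

theorem proposition31:
  fixes DA :: "((complex, 'n::{finite,linorder}) vec \<Rightarrow> complex) set"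
    and ip :: "((complex, 'n) vec \<Rightarrow> complex) \<Rightarrow> ((complex, 'n) vec \<Rightarrow> complex) \<Rightarrow> complex"
    and x :: "nat \<Rightarrow> (complex, 'n) vec" and r :: nat
    and K :: "nat \<Rightarrow> nat \<Rightarrow> complex"
  assumes "drury_arveson_space DA ip"
    and "inj_on x {1..r}"
    and "x ` {1..r} \<subseteq> ball 0 1"
    and "K = (\<lambda>i j. kernel_gram ip (x i) (x j))"
  shows "(lies_in_geodesic (x ` {1..r}) \<longleftrightarrow>
            (\<forall>i j k. 1 \<le> i \<and> i < j \<and> j < k \<and> k \<le> r \<longrightarrow>
               angular K i j k = 0 \<and> LF K i j k = delta K i k)) \<and>
         (lies_in_geodesic (x ` {1..r}) \<longleftrightarrow>
            (\<forall>i j k. 1 \<le> i \<and> i < j \<and> j < k \<and> k \<le> r \<longrightarrow>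
               angular K i j k = 0 \<and>
               det (MQ1 (kernel_gram ip) (x i) (vector [x j, x k] :: (_, 2) vec)) = 0))"
proof -
  interpret drury_arveson_space DA ip
    by fact
  have ball: "x i \<in> ball 0 1" if "i \<in> {1..r}" for i
    using assms(3) that by blast
  have K: "K i j = da_gram (x i) (x j)" if "i \<in> {1..r}" "j \<in> {1..r}" for i j
    using kernel_gram_eq ball that by (simp add: assms(4))
  have equiv: "(LF K i j k = delta K i k \<longleftrightarrow> mq_entry (x i) (x j) (x j) * mq_entry (x i) (x k) (x k) =
        mq_entry (x i) (x j) (x k) * mq_entry (x i) (x k) (x j))" (is ?LF)
    "det (MQ1 (kernel_gram ip) (x i) (vector [x j, x k] :: (_, 2) vec)) = 0 \<longleftrightarrow>
      mq_entry (x i) (x j) (x j) * mq_entry (x i) (x k) (x k) =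
        mq_entry (x i) (x j) (x k) * mq_entry (x i) (x k) (x j)" (is ?det)
    "angular K i j k = Arg (da_gram (x i) (x j) * da_gram (x j) (x k) * da_gram (x k) (x i))"
    if "1 \<le> i" "i < j" "j < k" "k \<le> r" for i j k
  proof -
    have mem: "i \<in> {1..r}" "j \<in> {1..r}" "k \<in> {1..r}"
      using that by auto
    note b = mem [THEN ball]
    \<comment> \<open>The pseudohyperbolic distance from the base point \<open>x i\<close>, shown
      below to be \<open>delta K i l\<close>.\<close>
    define d where "d l = norm (moebius (x i) (x l))" for l
    \<comment> \<open>Distinctness makes \<open>d j\<close> positive, so the division in
      \<open>LF\<close> is a genuine one.\<close>
    have ne: "x i \<noteq> x j"
      using inj_onD [OF assms(2), of i j] mem that by auto
    then have d: "d j > 0" "d k \<ge> 0"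
      unfolding d_def using moebius_nonzero [OF b(1,2)] by auto
    have delta: "delta K i l = d l" if l: "l \<in> {1..r}" for l
    proof -
      have "complex_of_real (1 - (cmod (K i l))\<^sup>2 / (Re (K i i) * Re (K l l))) =
          mq_entry (x i) (x l) (x l)"
      proof -
        have re: "complex_of_real (Re (K m m)) = K m m" if "m \<in> {1..r}" for m
          using that by (intro of_real_Re) (simp add: K Reals_cnj_iff cnj_da_gram)
        have "complex_of_real ((cmod (K i l))\<^sup>2) = K i l * cnj (K i l)"
          by (simp only: complex_norm_square)
        then show ?thesis
          using mem(1) l
          by (simp only: of_real_diff of_real_divide of_real_mult of_real_1 re)
            (simp add: K cnj_da_gram mq_entry_def mult.commute)
      qed
      also have "\<dots> = complex_of_real ((d l)\<^sup>2)"
        unfolding d_def by (rule mq_entry_diag [OF b(1) ball [OF l]])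
      finally show ?thesis
        unfolding of_real_eq_iff delta_def by (simp add: d_def)
    qed
    \<comment> \<open>\<open>MQ1\<close> is Hermitian, so the product of its off-diagonal entries is
      a squared modulus.\<close>
    have cnj: "mq_entry (x i) (x k) (x j) = cnj (mq_entry (x i) (x j) (x k))"
      by (simp add: mq_entry_def cnj_da_gram mult.commute)
    have LF: "LF K i j k = cmod (mq_entry (x i) (x j) (x k)) / d j"
      unfolding LF_def delta [OF mem(2)] using d(1) mem
      by (simp add: K mq_entry_def real_sqrt_divide)
    have "LF K i j k = delta K i k \<longleftrightarrow> d j * d k = cmod (mq_entry (x i) (x j) (x k))"
      unfolding LF delta [OF mem(3)] using d(1) by (auto simp: field_simps)
    \<comment> \<open>Both sides are nonnegative, so squaring loses nothing and produces the
      determinant condition.\<close>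
    also have "\<dots> \<longleftrightarrow> (d j * d k)\<^sup>2 = (cmod (mq_entry (x i) (x j) (x k)))\<^sup>2"
      using d by (simp add: power2_eq_iff_nonneg)
    also have "\<dots> \<longleftrightarrow> complex_of_real ((d j * d k)\<^sup>2) =
        complex_of_real ((cmod (mq_entry (x i) (x j) (x k)))\<^sup>2)"
      unfolding of_real_eq_iff ..
    also have "complex_of_real ((cmod (mq_entry (x i) (x j) (x k)))\<^sup>2) =
        mq_entry (x i) (x j) (x k) * mq_entry (x i) (x k) (x j)"
      unfolding cnj by (simp only: complex_norm_square)
    finally show ?LF
      unfolding d_def
      by (simp add: mq_entry_diag [OF b(1,2)] mq_entry_diag [OF b(1,3)] power_mult_distrib)
    show ?det
      using b by (simp add: det_2 MQ1_def mq_entry_def kernel_gram_eq del: mem_ball_0)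
    show "angular K i j k = Arg (da_gram (x i) (x j) * da_gram (x j) (x k) * da_gram (x k) (x i))"
      using mem by (simp add: angular_def K)
  qed
  have main: "lies_in_geodesic (x ` {1..r}) \<longleftrightarrow>
      (\<forall>i j k. 1 \<le> i \<and> i < j \<and> j < k \<and> k \<le> r \<longrightarrow> geodesic_triple (x i) (x j) (x k))"
  proof
    assume "lies_in_geodesic (x ` {1..r})"
    then show "\<forall>i j k. 1 \<le> i \<and> i < j \<and> j < k \<and> k \<le> r \<longrightarrow> geodesic_triple (x i) (x j) (x k)"
      by (intro allI impI geodesic_triple_if_lies_in_geodesic [of "x ` {1..r}"]) auto
  next
    assume tr: "\<forall>i j k. 1 \<le> i \<and> i < j \<and> j < k \<and> k \<le> r \<longrightarrow> geodesic_triple (x i) (x j) (x k)"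
    \<comment> \<open>Below two points there is no second point to fix a direction. For
      \<open>r = 2\<close> the pair \<open>x 1\<close>, \<open>x 2\<close> already determines the
      diameter, and the triple condition is vacuous.\<close>
    consider "r = 0" | "r = 1" | "r \<ge> 2"
      by linarith
    then show "lies_in_geodesic (x ` {1..r})"
    proof cases
      case 1
      then show ?thesis
        by (intro lies_in_geodesic_at_most_one_point [of _ 0]) auto
    next
      case 2
      then show ?thesis
        using ball [of 1] by (intro lies_in_geodesic_at_most_one_point [of _ "x 1"]) auto
    next
      case 3
      show ?thesis
      proof (rule lies_in_geodesic_if_geodesic_triples [OF assms(3), of "x 1" "x 2"])
        show "x 2 \<noteq> x 1"
          using inj_onD [OF assms(2), of 2 1] 3 by auto
        fix t assume t: "t \<in> x ` {1..r} - {x 1, x 2}"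
        then obtain k where k: "k \<in> {1..r}" "t = x k"
          by blast
        \<comment> \<open>Only the triples with indices \<open>1 < 2 < k\<close> are used, which are
          in increasing order as the hypothesis demands.\<close>
        with t have "k \<noteq> 1" "k \<noteq> 2"
          by auto
        with k(1) have "2 < k" "k \<le> r"
          by auto
        with tr k(2) show "geodesic_triple (x 1) (x 2) t"
          by (metis one_less_numeral_iff order_refl semiring_norm(76))
      qed (use 3 in auto)
    qed
  qed
  show ?thesis
    unfolding main geodesic_triple_def using equiv by (intro conjI iff_allI imp_cong refl) auto
qed

end
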